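(* Let $A\in\mathbb{R}^{n\times n}$ be symmetric with simple eigenvalues $\lambda_1,\dots,\lambda_n$, let $p$ be a permutation of $\{1,\dots,n\}$, let $1\le k<n$, and let $X=(x^{(p_1)},\dots,x^{(p_k)})\in\mathbb{R}^{n\times k}$ be the matrix of selected unit eigenvectors. Let $\widehat X\in\mathbb{R}^{n\times k}$ have full column rank, $\widehat X\ne X$, and let $\widetilde X=(\widetilde x^{(p_1)},\dots,\widetilde x^{(p_k)})$ be the output of one step of the refinement algorithm (defined in the context) applied to $A$ and $\widehat X$ in exact arithmetic. Let $E$ be the correction matrix defined in the context, let $\epsilon=\|E\|$, and assume $\epsilon<1/100$. Suppose that for every $1\le j\le k$ $$\epsilon\le \sqrt{\frac{\min_{1\le i\le k,\ i\ne j}|\lambda_{p_j}-\lambda_{p_i}|}{2\eta(\epsilon)\,k\,\|A\|}}\qquad\text{and}\qquad \epsilon<\sqrt{\frac{|\lambda_{p_j}|}{\eta(\epsilon)\|A\|}} .$$ Then for every $1\le j\le k$ $$\frac{\|x^{(p_j)}-\widetilde x^{(p_j)}\|}{\|X-\widehat X\|}\le \frac{1}{1-2\epsilon}\left(\frac{\omega(\epsilon)\sqrt{k}\,\|A\|\,\epsilon}{\min_{1\le i\le k,\ i\ne j}|\lambda_{p_j}-\lambda_{p_i}|-2\eta(\epsilon)\|A\|\epsilon^2}+\frac{\max_{k+1\le i\le n}|\lambda_{p_i}|+\omega(\epsilon)\|A\|\epsilon}{|\lambda_{p_j}|-\eta(\epsilon)\|A\|\epsilon^2}\right).$$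
   Context: Notation: $\|\cdot\|$ is the Euclidean norm for vectors and the spectral norm for matrices; $I_{n,k}$ is the matrix of the first $k$ columns of $I_n$. $(\lambda_i,x^{(i)})$, $i=1,\dots,n$, are the eigenpairs of $A$, with $\|x^{(i)}\|=1$. The exact orthogonal matrix: $H\in\mathbb{R}^{n\times n}$ is an orthogonal matrix with $H^{\mathsf T}X=I_{n,k}$ and $H^{\mathsf T}AH=\mathrm{diag}(D_1,D_2)$ (block diagonal), where $D_1=\mathrm{diag}(\lambda_{p_1},\dots,\lambda_{p_k})$ and $D_2\in\mathbb{R}^{(n-k)\times(n-k)}$ is symmetric. The approximate matrix: $\widehat H=I_n-\widehat Y\widehat T\widehat Y^{\mathsf T}$ with $\widehat Y\in\mathbb{R}^{n\times k}$, $\widehat T\in\mathbb{R}^{k\times k}$ is the compact WY matrix constructed from $\widehat X$, whose first $k$ columns are $\widehat X$, i.e. $\widehat H I_{n,k}=\widehat X$ (for example $\widehat Y=\widehat X-I_{n,k}$ and $\widehat T=-\widehat Y_1^{-\mathsf T}$, where $\widehat Y_1$ is the leading $k\times k$ block of $\widehat Y$, assumed nonsingular). $\widehat H$ is assumed nonsingular. The correction matrix $E\in\mathbb{R}^{n\times n}$ is defined by $H=\widehat H(I_n+E)$. Its first $k$ columns form $E_L\in\mathbb{R}^{n\times k}$, so $X=\widehat X+\widehat HE_L$. One step of the refinement algorithm: given $A$ and $\widehat X=(\widehat x_1,\dots,\widehat x_k)$, set $\alpha_j=\widehat x_j^{\mathsf T}\widehat x_j$, $\widetilde d_j=(\widehat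 x_j^{\mathsf T}A\widehat x_j)/\alpha_j$ for $1\le j\le k$, $\widetilde D_1=\mathrm{diag}(\widetilde d_1,\dots,\widetilde d_k)$, $V=(v_{ij})=\widehat H^{\mathsf T}(A\widehat X-\widehat X\widetilde D_1)\in\mathbb{R}^{n\times k}$; define $\widetilde E_L=(\widetilde e_{ij})\in\mathbb{R}^{n\times k}$ by $\widetilde e_{jj}=(1-\alpha_j)/2$ for $1\le j\le k$; $\widetilde e_{ij}=v_{ij}/(\widetilde d_j-\widetilde d_i)$ for $1\le i\ne j\le k$; $\widetilde e_{ij}=v_{ij}/\widetilde d_j$ for $k+1\le i\le n$, $1\le j\le k$. The output is $\widetilde X=\widehat X+\widehat H\widetilde E_L$; its $j$th column is denoted $\widetilde x^{(p_j)}$. Functions: $\chi(\epsilon)=\dfrac{3-2\epsilon}{(1-\epsilon)^2}$, $\quad\eta(\epsilon)=\dfrac{2(1+2\epsilon+\chi(\epsilon)\epsilon^2)\chi(\epsilon)}{(1-\epsilon)(1-2\epsilon-\chi(\epsilon)\epsilon^2)}$, $\quad\omega(\epsilon)=2\chi(\epsilon)+2\eta(\epsilon)\epsilon+\chi(\epsilon)\eta(\epsilon)\epsilon^2$. If $k=1$, the minimum over the empty set is read as $+\infty$: the first bound on $\epsilon$ is void and the first term in the parentheses is $0$. *)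

theory Defs
  imports "HOL-Analysis.Analysis" "HOL-Combinatorics.Permutations"
begin

text \<open>
  The index set $\{1,\dots,n\}$ is rendered as a sum type \<open>'k + 'm\<close> of two finite types:
  \<open>Inl j\<close> is one of the first $k$ indices and \<open>Inr i\<close> one of the last $n - k$ ones, so
  $k$ is \<open>CARD('k)\<close>, $n$ is \<open>CARD('k) + CARD('m)\<close>, and $1 \le k < n$ holds because types are
  nonempty.  An $n \times k$ matrix has type \<open>real^'k^('k + 'm)\<close> (rows are the outer index).
\<close>

definition spectral_norm :: "real^'b::finite^'a::finite \<Rightarrow> real"
  where "spectral_norm M = onorm ((*v) M)"

definition I_nk :: "real^'k::finite^('k + 'm::finite)"
  where "I_nk = (\<chi> i j. if i = Inl j then 1 else 0)"

definition diag_mat :: "('a::finite \<Rightarrow> real) \<Rightarrow> real^'a^'a"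
  where "diag_mat d = (\<chi> i j. if i = j then d i else 0)"

definition block_diag ::
  "real^'k::finite^'k \<Rightarrow> real^'m::finite^'m \<Rightarrow> real^('k + 'm)^('k + 'm)"
  where "block_diag D1 D2 = (\<chi> i j. case (i, j) of
      (Inl a, Inl b) \<Rightarrow> D1 $ a $ b
    | (Inr a, Inr b) \<Rightarrow> D2 $ a $ b
    | _ \<Rightarrow> 0)"

definition alpha :: "real^'k::finite^'n::finite \<Rightarrow> 'k \<Rightarrow> real"
  where "alpha Xh j = column j Xh \<bullet> column j Xh"

definition d_tilde :: "real^'n^'n \<Rightarrow> real^'k::finite^'n::finite \<Rightarrow> 'k \<Rightarrow> real"
  where "d_tilde A Xh j = (column j Xh \<bullet> (A *v column j Xh)) / alpha Xh j"

definition V_mat ::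
  "real^'n^'n \<Rightarrow> real^'k::finite^'n::finite \<Rightarrow> real^'n^'n \<Rightarrow> real^'k^'n"
  where "V_mat A Xh Hh = transpose Hh ** (A ** Xh - Xh ** diag_mat (d_tilde A Xh))"

definition E_tilde ::
  "real^('k + 'm)^('k + 'm) \<Rightarrow> real^'k::finite^('k + 'm::finite)
    \<Rightarrow> real^('k + 'm)^('k + 'm) \<Rightarrow> real^'k^('k + 'm)"
  where "E_tilde A Xh Hh = (\<chi> i j. case i of
      Inl i' \<Rightarrow> (if i' = j then (1 - alpha Xh j) / 2
                 else V_mat A Xh Hh $ i $ j / (d_tilde A Xh j - d_tilde A Xh i'))
    | Inr _ \<Rightarrow> V_mat A Xh Hh $ i $ j / d_tilde A Xh j)"

definition refine_step ::
  "real^('k + 'm)^('k + 'm) \<Rightarrow> real^'k::finite^('k + 'm::finite)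
    \<Rightarrow> real^('k + 'm)^('k + 'm) \<Rightarrow> real^'k^('k + 'm)"
  where "refine_step A Xh Hh = Xh + Hh ** E_tilde A Xh Hh"

definition chi_fn :: "real \<Rightarrow> real"
  where "chi_fn e = (3 - 2 * e) / (1 - e)^2"

definition eta_fn :: "real \<Rightarrow> real"
  where "eta_fn e = 2 * (1 + 2 * e + chi_fn e * e^2) * chi_fn e
                    / ((1 - e) * (1 - 2 * e - chi_fn e * e^2))"

definition omega_fn :: "real \<Rightarrow> real"
  where "omega_fn e = 2 * chi_fn e + 2 * eta_fn e * e + chi_fn e * eta_fn e * e^2"

text \<open>
  Here \<open>mu\<close> lists the selected eigenvalues.  The minimum is over an empty set, and hence
  unspecified, if $k = 1$; every use of it must be guarded by \<open>CARD('k) \<noteq> 1\<close>.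
\<close>

definition gap :: "('k::finite \<Rightarrow> real) \<Rightarrow> 'k \<Rightarrow> real"
  where "gap mu j = Min {\<bar>mu j - mu i\<bar> | i. i \<noteq> j}"

end

theory Submission
  imports Defs
begin

text \<open>
  In the coordinates of \<open>H\<close> put \<open>F = (I + E)\<^sup>-\<^sup>1\<close> and \<open>D = H\<^sup>T A H\<close>, so that \<open>Hhat = H F\<close>.
  The matrix \<open>E\<close> can be much larger than its first \<open>k\<close> columns, so it is not enough to bound the
  entries of \<open>F\<^sup>T F\<close> and \<open>F\<^sup>T D F\<close> to second order in \<open>\<epsilon>\<close>: every error must carry a factor
  \<open>\<parallel>u\<parallel>\<close>, where \<open>u = E e\<^sub>j\<close>. This is obtained from \<open>xhat\<^sub>j = x\<^sub>j - H F u\<close>, which gives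
  \<open>v\<^sub>j = (\<lambda>\<^sub>j - d\<^sub>j) F\<^sup>T e\<^sub>j - F\<^sup>T (D - d\<^sub>j) F u\<close>. As \<open>d\<^sub>j\<close> is a Rayleigh quotient,
  \<open>\<lambda>\<^sub>j - d\<^sub>j = O(\<parallel>A\<parallel> \<parallel>u\<parallel>\<^sup>2)\<close>, and \<open>v\<^sub>j\<close> differs from \<open>(\<lambda>\<^sub>j - d\<^sub>j) e\<^sub>j - (D - d\<^sub>j) u\<close> by
  less than \<open>5 \<parallel>A\<parallel> \<epsilon> \<parallel>u\<parallel>\<close>. Dividing by \<open>d\<^sub>j - d\<^sub>i\<close> or \<open>d\<^sub>j\<close> compares the computed correction with
  \<open>u\<close>; the term \<open>D u\<close> left over in the last \<open>n - k\<close> rows is bounded by the largest unselected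
  \<open>\<bar>\<lambda>\<bar>\<close>. The constants fit because \<open>\<omega> \<ge> 6\<close> and \<open>\<eta> \<ge> 6\<close>, and the factor \<open>1 / (1 - 2\<epsilon>)\<close>
  dominates the condition number \<open>(1 + \<epsilon>) / (1 - \<epsilon>)\<close> of \<open>Hhat\<close>.
\<close>

section \<open>Spectral norms, transposes and orthogonal matrices\<close>

lemma spectral_norm_bound: "norm (M *v v) \<le> spectral_norm M * norm v"
  unfolding spectral_norm_def
  by (rule onorm[OF matrix_vector_mul_bounded_linear])

lemma spectral_norm_nonneg: "0 \<le> spectral_norm M"
  unfolding spectral_norm_def
  by (rule onorm_pos_le[OF matrix_vector_mul_bounded_linear])

lemma spectral_norm_pos:
  assumes "M \<noteq> 0" shows "0 < spectral_norm M"
proof -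
  have "\<exists>v. M *v v \<noteq> 0"
    using assms by (metis matrix_eq matrix_vector_mult_0)
  then show ?thesis
    unfolding spectral_norm_def
    using onorm_pos_lt[OF matrix_vector_mul_bounded_linear, of M] by blast
qed

lemma inner_transpose_mult: "(transpose M *v v) \<bullet> w = v \<bullet> (M *v w)"
  for M :: "real^'n::finite^'m::finite"
  by (simp add: dot_lmul_matrix)

text \<open>Pairing \<open>transpose M *v v\<close> with itself moves \<open>M\<close> to the other
  factor. The bound \<open>c\<close> is arbitrary, so that the lemma applies to matrices known only
  through an estimate.\<close>

lemma norm_transpose_mult_le:
  fixes M :: "real^'n::finite^'m::finite"
  assumes "\<And>v. norm (M *v v) \<le> c * norm v"
  shows "norm (transpose M *v v) \<le> c * norm v"
proof (cases "transpose M *v v = 0")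
  case True
  \<comment> \<open>Any nonzero vector would do here: the assumption then forces \<open>c\<close> to
    be nonnegative.\<close>
  have "0 \<le> c * norm (1 :: real^'n)"
    by (rule order_trans[OF norm_ge_zero assms])
  then have "0 \<le> c" by (simp add: zero_le_mult_iff)
  then show ?thesis using True by simp
next
  case False
  let ?t = "transpose M *v v"
  have "norm ?t * norm ?t = v \<bullet> (M *v ?t)"
    by (metis inner_transpose_mult power2_eq_square power2_norm_eq_inner)
  also have "\<dots> \<le> norm v * norm (M *v ?t)" by (rule norm_cauchy_schwarz)
  also have "\<dots> \<le> norm v * (c * norm ?t)" by (intro mult_left_mono assms) simp
  finally have "norm ?t * norm ?t \<le> (c * norm v) * norm ?t" by (simp add: mult_ac)
  then show ?thesis using False by simp
qed

lemma norm_orthogonal_matrix_mult: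
  fixes Q :: "real^'n::finite^'n"
  assumes "orthogonal_matrix Q"
  shows "norm (Q *v v) = norm v"
  using assms orthogonal_transformation_matrix[of "(*v) Q"] orthogonal_transformation_norm
  by auto

section \<open>Eigenvalues, Rayleigh quotients and near-identity congruences\<close>

lemma eigenvalue_le_spectral_norm:
  assumes "A *v x = l *\<^sub>R x" "norm x = 1"
  shows "\<bar>l\<bar> \<le> spectral_norm A"
  using spectral_norm_bound[of A x] assms by simp

text \<open>Since \<open>A - l\<close> annihilates the eigenvector, only terms quadratic in \<open>w\<close> survive.\<close>

lemma rayleigh_quotient_error:
  fixes A :: "real^'n::finite^'n"
  assumes sym: "transpose A = A" and eig: "A *v x = l *\<^sub>R x" "norm x = 1"
    and y: "y = x - w" and w: "norm w < 1"
  shows "\<bar>(y \<bullet> (A *v y)) / (y \<bullet> y) - l\<bar> \<le> 2 * spectral_norm A * (norm w)\<^sup>2 / (1 - norm w)\<^sup>2"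
proof -
  have "x \<bullet> (A *v w) = l * (x \<bullet> w)"
    using inner_transpose_mult[of A x w] sym eig by simp
  then have num: "y \<bullet> (A *v y) - l * (y \<bullet> y) = w \<bullet> (A *v w) - l * (w \<bullet> w)"
    using eig by (simp add: y matrix_vector_mult_diff_distrib inner_diff_left inner_diff_right
        algebra_simps inner_commute)
  have "1 - norm w \<le> norm y"
    using norm_triangle_ineq2[of x w] eig y by simp
  then have den: "(1 - norm w)\<^sup>2 \<le> y \<bullet> y"
    unfolding power2_norm_eq_inner[symmetric] using w by (intro power_mono) auto
  have pos: "0 < (1 - norm w)\<^sup>2" using w by simp
  have "\<bar>w \<bullet> (A *v w)\<bar> \<le> norm w * (spectral_norm A * norm w)"
    by (rule order_trans[OF Cauchy_Schwarz_ineq2])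
       (intro mult_left_mono spectral_norm_bound norm_ge_zero)
  moreover have "\<bar>l * (w \<bullet> w)\<bar> \<le> spectral_norm A * (norm w)\<^sup>2"
    using eigenvalue_le_spectral_norm[OF eig]
    by (simp add: abs_mult power2_norm_eq_inner mult_right_mono)
  ultimately have ub: "\<bar>w \<bullet> (A *v w) - l * (w \<bullet> w)\<bar> \<le> 2 * spectral_norm A * (norm w)\<^sup>2"
    by (simp add: power2_eq_square mult_ac)
  have "(y \<bullet> (A *v y)) / (y \<bullet> y) - l = (w \<bullet> (A *v w) - l * (w \<bullet> w)) / (y \<bullet> y)"
    using den pos unfolding num[symmetric] by (auto simp: diff_divide_distrib)
  then have "\<bar>(y \<bullet> (A *v y)) / (y \<bullet> y) - l\<bar> = \<bar>w \<bullet> (A *v w) - l * (w \<bullet> w)\<bar> / (y \<bullet> y)"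
    by (simp add: abs_divide)
  also have "\<dots> \<le> 2 * spectral_norm A * (norm w)\<^sup>2 / (1 - norm w)\<^sup>2"
    using ub den pos by (intro frac_le) (auto intro: order_trans[OF abs_ge_zero])
  finally show ?thesis .
qed

text \<open>Expanding \<open>F = mat 1 - G\<close> leaves two terms linear in \<open>G\<close> and
  one quadratic term; the vector \<open>u\<close> stays as a factor in each.\<close>

lemma norm_congruence_perturbation:
  fixes F G M :: "real^'n::finite^'n"
  assumes F: "F = mat 1 - G"
    and G: "\<And>v. norm (G *v v) \<le> g * norm v"
    and M: "\<And>v. norm (M *v v) \<le> m * norm v"
    and "0 \<le> g" "0 \<le> m"
  shows "norm (transpose F *v (M *v (F *v u)) - M *v u) \<le> (2 * g + g\<^sup>2) * m * norm u"
proof -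
  note Gt = norm_transpose_mult_le[of G, OF G]
  have tF: "transpose F = mat 1 - transpose G"
    by (simp add: F transpose_def mat_def vec_eq_iff)
  have 1: "norm (M *v (G *v u)) \<le> m * (g * norm u)"
    by (rule order_trans[OF M mult_left_mono[OF G]]) fact
  have 2: "norm (transpose G *v (M *v u)) \<le> g * (m * norm u)"
    by (rule order_trans[OF Gt mult_left_mono[OF M]]) fact
  have 3: "norm (transpose G *v (M *v (G *v u))) \<le> g * (m * (g * norm u))"
    by (rule order_trans[OF Gt mult_left_mono[OF 1]]) fact
  have "transpose F *v (M *v (F *v u)) - M *v u
      = transpose G *v (M *v (G *v u)) - transpose G *v (M *v u) - M *v (G *v u)"
    unfolding tF unfolding F
    by (simp add: matrix_vector_mult_diff_rdistrib matrix_vector_mult_diff_distrib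
        del: transpose_matrix_vector)
  also have "norm \<dots> \<le> g * (m * (g * norm u)) + g * (m * norm u) + m * (g * norm u)"
    using norm_triangle_le_diff 1 2 3 by (smt (verit) norm_triangle_ineq4)
  also have "\<dots> = (2 * g + g\<^sup>2) * m * norm u"
    by (simp add: algebra_simps power2_eq_square)
  finally show ?thesis .
qed

lemma eigenvectors_orthonormal:
  fixes A :: "real^'n::finite^'n" and x :: "'n \<Rightarrow> real^'n"
  assumes sym: "transpose A = A" and eig: "\<And>i. A *v x i = l i *\<^sub>R x i" "\<And>i. norm (x i) = 1"
    and "inj l"
  shows "orthogonal_matrix (\<chi> i. x i)"
proof -
  have "x i \<bullet> x j = 0" if "i \<noteq> j" for i j
  proof -
    have "l i * (x i \<bullet> x j) = l j * (x i \<bullet> x j)"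
      using inner_transpose_mult[of A "x i" "x j"] sym eig by simp
    then show ?thesis using \<open>inj l\<close> that by (auto dest: injD)
  qed
  then show ?thesis
    using eig(2) by (simp add: orthogonal_matrix_orthonormal_rows row_def pairwise_def orthogonal_def)
qed

text \<open>In the orthonormal eigenbasis \<open>A\<close> multiplies the coordinate
  \<open>i\<close> by \<open>l i\<close>, so only eigenvalues with a nonzero coordinate of
  \<open>z\<close> count. This brings in the unselected eigenvalues alone.\<close>

lemma norm_mult_eigenspace_le:
  fixes A :: "real^'n::finite^'n" and x :: "'n \<Rightarrow> real^'n"
  assumes sym: "transpose A = A" and eig: "\<And>i. A *v x i = l i *\<^sub>R x i" "\<And>i. norm (x i) = 1"
    and "inj l" and c: "\<And>i. x i \<bullet> z = 0 \<or> \<bar>l i\<bar> \<le> c" and "0 \<le> c"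
  shows "norm (A *v z) \<le> c * norm z"
proof -
  define Q where "Q = (\<chi> i. x i)"
  have Q: "orthogonal_matrix Q"
    unfolding Q_def by (rule eigenvectors_orthonormal[OF sym eig \<open>inj l\<close>])
  have Qv: "(Q *v v) $ i = x i \<bullet> v" for v i
    by (simp add: Q_def matrix_vector_mul_component)
  have "norm (A *v z) = norm (Q *v (A *v z))"
    using norm_orthogonal_matrix_mult[OF Q] by simp
  also have "\<dots> \<le> norm (c *\<^sub>R (Q *v z))"
  proof (rule norm_le_componentwise_cart)
    fix i
    have "x i \<bullet> (A *v z) = l i * (x i \<bullet> z)"
      using inner_transpose_mult[of A "x i" z] sym eig by simp
    then show "norm ((Q *v (A *v z)) $ i) \<le> norm ((c *\<^sub>R (Q *v z)) $ i)"
      using c[of i] \<open>0 \<le> c\<close> by (auto simp: Qv abs_mult mult_right_mono)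
  qed
  also have "\<dots> = c * norm z"
    using norm_orthogonal_matrix_mult[OF Q] \<open>0 \<le> c\<close> by simp
  finally show ?thesis .
qed

section \<open>Bounds for the rational functions of the theorem, and the eigenvalue gap\<close>

lemma chi_fn_bounds:
  assumes "0 \<le> e" "e < 1 / 100"
  shows "3 \<le> chi_fn e" "chi_fn e \<le> 4"
proof -
  have "e * e \<le> e" "0 \<le> e * e" using assms mult_right_mono[of e 1 e] by auto
  moreover have "(1 - e)\<^sup>2 = 1 - 2 * e + e * e" by (simp add: power2_eq_square algebra_simps)
  ultimately have "3 * (1 - e)\<^sup>2 \<le> 3 - 2 * e" "3 - 2 * e \<le> 4 * (1 - e)\<^sup>2" "0 < (1 - e)\<^sup>2"
    using assms by linarith+
  then show "3 \<le> chi_fn e" "chi_fn e \<le> 4"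
    by (simp_all add: chi_fn_def pos_le_divide_eq pos_divide_le_eq)
qed

text \<open>With \<open>q\<close> as below, the numerator is at least 6 and the denominator
  \<open>(1 - e) * (1 - q)\<close> lies in \<open>(0, 1]\<close>. The bound
  \<open>chi_fn e \<le> 4\<close> serves to keep \<open>q < 1\<close>.\<close>

lemma eta_fn_ge:
  assumes "0 \<le> e" "e < 1 / 100"
  shows "6 \<le> eta_fn e"
proof -
  note chi = chi_fn_bounds[OF assms]
  define q where "q = 2 * e + chi_fn e * e\<^sup>2"
  have "chi_fn e * e\<^sup>2 \<le> 4 * (1/100)\<^sup>2"
    using assms chi by (intro mult_mono power_mono) auto
  moreover have "0 \<le> chi_fn e * e\<^sup>2" using chi by simp
  ultimately have q: "0 \<le> q" "q < 1" using assms by (auto simp: q_def power2_eq_square)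
  have "(1 - e) * (1 - q) \<le> 1 * 1" using q assms by (intro mult_mono) auto
  moreover have "0 < (1 - e) * (1 - q)" using q assms by simp
  moreover have "2 * 1 * 3 \<le> 2 * (1 + q) * chi_fn e" using q chi by (intro mult_mono) auto
  ultimately have "6 / 1 \<le> 2 * (1 + q) * chi_fn e / ((1 - e) * (1 - q))"
    by (intro frac_le) auto
  then show ?thesis by (simp add: eta_fn_def q_def algebra_simps)
qed

lemma omega_fn_ge:
  assumes "0 \<le> e" "e < 1 / 100"
  shows "6 \<le> omega_fn e"
proof -
  have "0 \<le> eta_fn e * e" "0 \<le> chi_fn e * eta_fn e * e\<^sup>2"
    using chi_fn_bounds(1)[OF assms] eta_fn_ge[OF assms] assms by auto
  then show ?thesis
    using chi_fn_bounds(1)[OF assms] by (simp add: omega_fn_def)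
qed

lemma gap_le:
  fixes mu :: "'k::finite \<Rightarrow> real"
  assumes "i \<noteq> j" shows "gap mu j \<le> \<bar>mu j - mu i\<bar>"
  unfolding gap_def using assms by (intro Min_le) auto

lemma gap_pos:
  fixes mu :: "'k::finite \<Rightarrow> real"
  assumes "CARD('k) \<noteq> 1" "inj mu" shows "0 < gap mu j"
proof -
  have "\<exists>i. i \<noteq> j"
    using assms(1) by (metis UNIV_eq_I insertCI is_singletonI is_singleton_altdef)
  then have "{\<bar>mu j - mu i\<bar> | i. i \<noteq> j} \<noteq> {}" by auto
  moreover have "finite {\<bar>mu j - mu i\<bar> | i. i \<noteq> j}" by simp
  ultimately show ?thesis
    unfolding gap_def using assms(2) by (subst Min_gr_iff) (auto dest: injD)
qed

section \<open>Columns and the two-block index set\<close>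

lemma column_matrix_mult: "column j (M ** N) = M *v column j N"
  by (simp add: vec_eq_iff column_def matrix_matrix_mult_def matrix_vector_mult_def)

lemma column_I_nk: "column j I_nk = axis (Inl j) 1"
  by (auto simp: vec_eq_iff column_def I_nk_def axis_def)

lemma sum_UNIV_sum:
  fixes f :: "'k::finite + 'm::finite \<Rightarrow> 'b::comm_monoid_add"
  shows "(\<Sum>i\<in>UNIV. f i) = (\<Sum>i\<in>UNIV. f (Inl i)) + (\<Sum>i\<in>UNIV. f (Inr i))"
  by (simp add: sum.Plus flip: UNIV_Plus_UNIV)

lemma block_diag_mult_Inl:
  "(block_diag (diag_mat d) D2 *v u) $ Inl i = d i * u $ Inl i"
  by (simp add: matrix_vector_mult_def sum_UNIV_sum block_diag_def diag_mat_def if_distrib[where f="\<lambda>x. x * _"]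
      cong: if_cong)

lemma block_diag_mult_Inr:
  assumes "\<And>i. v $ Inr i = u $ Inr i"
  shows "(block_diag D1 D2 *v u) $ Inr i = (block_diag D1 D2 *v v) $ Inr i"
  using assms by (simp add: matrix_vector_mult_def sum_UNIV_sum block_diag_def)

text \<open>The three kinds of entries of the computed correction (diagonal, rest of the first
  block, last block) are estimated separately. Absolute values in \<open>t'\<close> and
  \<open>s'\<close> rule out cancellation, so \<open>y\<close> is dominated entrywise by one sum of
  three vectors.\<close>

lemma norm_sum_type_le:
  fixes y s t :: "real^('k::finite + 'm::finite)"
  assumes d: "\<bar>y $ Inl j\<bar> \<le> d"
    and t: "\<And>i. i \<noteq> j \<Longrightarrow> \<bar>y $ Inl i\<bar> \<le> \<bar>t $ Inl i\<bar>"
    and s: "\<And>i. \<bar>y $ Inr i\<bar> \<le> \<bar>s $ Inr i\<bar>"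
  shows "norm y \<le> d + norm t + norm s"
proof -
  define t' s' :: "real^('k + 'm)" where "t' = (\<chi> i. \<bar>t $ i\<bar>)" and "s' = (\<chi> i. \<bar>s $ i\<bar>)"
  have "0 \<le> d" using d by linarith
  have "norm y \<le> norm (axis (Inl j) d + t' + s')"
  proof (rule norm_le_componentwise_cart)
    fix i show "norm (y $ i) \<le> norm ((axis (Inl j) d + t' + s') $ i)"
    proof (cases i)
      case (Inl l)
      then show ?thesis
        using d t[of l] \<open>0 \<le> d\<close> by (cases "l = j") (auto simp: axis_def t'_def s'_def)
    next
      case (Inr l)
      then show ?thesis
        using s[of l] by (auto simp: axis_def t'_def s'_def)
    qed
  qed
  also have "\<dots> \<le> norm (axis (Inl j) d :: real^('k + 'm)) + norm t' + norm s'"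
    by (intro norm_triangle_le add_right_mono norm_triangle_ineq)
  also have "norm (axis (Inl j) d :: real^('k + 'm)) = d"
    using \<open>0 \<le> d\<close> by (simp add: norm_eq_sqrt_inner inner_axis_axis)
  also have "norm t' \<le> norm t" by (rule norm_le_componentwise_cart) (simp add: t'_def)
  also have "norm s' \<le> norm s" by (rule norm_le_componentwise_cart) (simp add: s'_def)
  finally show ?thesis by simp
qed

lemma mat_vector_mult: "mat c *v v = c *\<^sub>R v"
  for v :: "real^'n::finite"
  by (simp add: vec_eq_iff mat_def matrix_vector_mult_def if_distrib[where f="\<lambda>x. x * _"]
      cong: if_cong)

section \<open>First-order expansion of a column of the residual\<close>

text \<open>In the coordinates of \<open>H\<close> the residual is
  \<open>(l - c) *\<^sub>R e - M *v (F *v u)\<close>. Applying \<open>transpose F\<close> changes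
  the first term by \<open>transpose G *v e\<close>, which gives \<open>\<rho> * g\<close>, and
  turns the second into a congruence of \<open>M\<close>.\<close>

lemma residual_column_expansion:
  fixes A H F G :: "real^'n::finite^'n"
  assumes eig: "A *v (H *v e) = l *\<^sub>R (H *v e)" "norm e = 1"
    and H: "orthogonal_matrix H"
    and F: "F = mat 1 - G"
    and G: "\<And>v. norm (G *v v) \<le> g * norm v" "0 \<le> g"
    and l: "\<bar>l\<bar> \<le> spectral_norm A" "\<bar>c - l\<bar> \<le> \<rho>"
    and y: "y = H *v e - H *v (F *v u)"
  shows "norm (transpose (H ** F) *v (A *v y - c *\<^sub>R y)
           - ((l - c) *\<^sub>R e - (transpose H ** A ** H *v u - c *\<^sub>R u)))
         \<le> \<rho> * g + (2 * g + g\<^sup>2) * (2 * spectral_norm A + \<rho>) * norm u"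
proof -
  define M where "M = transpose H ** A ** H - mat c"
  have HH: "transpose H *v (H *v v) = v" for v
    using H by (simp add: orthogonal_matrix_def matrix_vector_mul_assoc del: transpose_matrix_vector)
  have Mv: "M *v v = transpose H *v (A *v (H *v v)) - c *\<^sub>R v" for v
    by (simp add: M_def matrix_vector_mult_diff_rdistrib matrix_vector_mul_assoc
        matrix_mul_assoc mat_vector_mult del: transpose_matrix_vector)
  have "orthogonal_matrix (transpose H)" using H by simp
  then have Ht: "norm (transpose H *v v) = norm v" for v by (rule norm_orthogonal_matrix_mult)
  \<comment> \<open>The shift satisfies \<open>\<bar>c\<bar> \<le> spectral_norm A + \<rho>\<close>,
    as \<open>c\<close> is within \<open>\<rho>\<close> of the eigenvalue \<open>l\<close>.\<close>
  have M: "norm (M *v v) \<le> (2 * spectral_norm A + \<rho>) * norm v" for v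
  proof -
    have "norm (M *v v) \<le> norm (transpose H *v (A *v (H *v v))) + norm (c *\<^sub>R v)"
      unfolding Mv by (rule norm_triangle_ineq4)
    also have "norm (transpose H *v (A *v (H *v v))) \<le> spectral_norm A * norm v"
      using spectral_norm_bound[of A "H *v v"] norm_orthogonal_matrix_mult[OF H] Ht by metis
    also have "norm (c *\<^sub>R v) \<le> (spectral_norm A + \<rho>) * norm v"
      using l by (simp, intro mult_right_mono) auto
    finally show ?thesis by (simp add: algebra_simps)
  qed
  have tF: "transpose F *v v = v - transpose G *v v" for v
    by (simp add: F transpose_def mat_def vec_eq_iff matrix_vector_mult_def left_diff_distrib
        sum_subtractf if_distrib[where f="\<lambda>x. x * _"] cong: if_cong)
  have res: "transpose H *v (A *v y - c *\<^sub>R y) = (l - c) *\<^sub>R e - M *v (F *v u)"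
    unfolding y Mv
    by (simp add: eig matrix_vector_mult_diff_distrib matrix_vector_mult_scaleR HH algebra_simps
        del: transpose_matrix_vector)
  have "transpose (H ** F) *v (A *v y - c *\<^sub>R y)
      = transpose F *v (transpose H *v (A *v y - c *\<^sub>R y))"
    by (simp add: matrix_transpose_mul matrix_vector_mul_assoc del: transpose_matrix_vector)
  also have "\<dots> = (l - c) *\<^sub>R (transpose F *v e) - transpose F *v (M *v (F *v u))"
    unfolding res by (simp add: matrix_vector_mult_diff_distrib matrix_vector_mult_scaleR
        del: transpose_matrix_vector)
  also have "transpose F *v e = e - transpose G *v e" by (rule tF)
  finally have "transpose (H ** F) *v (A *v y - c *\<^sub>R y)
           - ((l - c) *\<^sub>R e - (transpose H ** A ** H *v u - c *\<^sub>R u))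
      = - ((l - c) *\<^sub>R (transpose G *v e)) - (transpose F *v (M *v (F *v u)) - M *v u)"
    by (simp add: M_def matrix_vector_mult_diff_rdistrib mat_vector_mult algebra_simps
        del: transpose_matrix_vector)
  also have "norm \<dots> \<le> norm ((l - c) *\<^sub>R (transpose G *v e))
      + norm (transpose F *v (M *v (F *v u)) - M *v u)"
    by (metis norm_minus_cancel norm_triangle_ineq4)
  also have "norm ((l - c) *\<^sub>R (transpose G *v e)) \<le> \<rho> * (g * norm e)"
    unfolding norm_scaleR using l norm_transpose_mult_le[of G g e, OF G(1)]
    by (intro mult_mono) (auto simp: abs_minus_commute)
  also have "norm (transpose F *v (M *v (F *v u)) - M *v u)
      \<le> (2 * g + g\<^sup>2) * (2 * spectral_norm A + \<rho>) * norm u"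
    using l spectral_norm_nonneg[of A] G(2)
    by (intro norm_congruence_perturbation[OF F G(1) M]) auto
  finally show ?thesis using eig by simp
qed

text \<open>This is the preceding bound for \<open>g = 51 / 50 * e\<close> and
  \<open>\<rho> = 3 * a * r\<^sup>2\<close>. The leading coefficient is \<open>4 * 51 / 50\<close>;
  the higher-order terms fit into the slack up to \<open>17 / 4\<close>.\<close>

lemma residual_error_numeric:
  fixes a r e :: real
  assumes "0 \<le> a" "0 \<le> r" "r \<le> e" "e < 1 / 100"
  shows "3 * a * r\<^sup>2 * (51 / 50 * e) + (2 * (51 / 50 * e) + (51 / 50 * e)\<^sup>2) * (2 * a + 3 * a * r\<^sup>2) * r
      \<le> 17 / 4 * a * e * r" (is "?A + ?B * ?C * r \<le> _")
proof -
  have e: "0 \<le> e" and r: "r \<le> 1 / 100" using assms by auto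
  have "3 * a * r\<^sup>2 * (51 / 50 * e) = (153 / 50 * (a * e * r)) * r"
    by (simp add: power2_eq_square)
  also have "\<dots> \<le> (153 / 50 * (a * e * r)) * (1 / 100)"
    using assms e r by (intro mult_left_mono) auto
  finally have 1: "?A \<le> 153 / 5000 * (a * e * r)" by simp
  have "e * e \<le> e * (1 / 100)" using assms e by (intro mult_left_mono) auto
  with e have B: "?B \<le> 41 / 20 * e + 1 / 500 * e" by (simp add: power2_eq_square)
  have "r * r \<le> (1 / 100) * (1 / 100)" using assms r by (intro mult_mono) auto
  then have "a * (r * r) \<le> a * (1 / 10000)" using assms by (intro mult_left_mono) auto
  then have C: "?C \<le> 20003 / 10000 * a" by (simp add: power2_eq_square)
  have "?B * ?C * r \<le> (41 / 20 * e + 1 / 500 * e) * (20003 / 10000 * a) * r"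
    using assms e B C by (intro mult_right_mono mult_mono) auto
  also have "\<dots> \<le> 42 / 10 * (a * e * r)"
    using assms e by (auto simp: algebra_simps)
  finally have 2: "?B * ?C * r \<le> 42 / 10 * (a * e * r)" .
  have "0 \<le> a * e * r" using assms e by simp
  then have "?A + ?B * ?C * r \<le> 17 / 4 * (a * e * r)" using 1 2 by linarith
  then show ?thesis by (simp only: mult.assoc)
qed

text \<open>Here \<open>1 - w\<close> is at least \<open>49 / 50\<close>, and
  \<open>2 * (51 / 49)\<^sup>2 < 3\<close>.\<close>

lemma rayleigh_error_numeric:
  fixes a r w :: real
  assumes "0 \<le> a" "0 \<le> w" "w \<le> 51 / 50 * r" "r < 1 / 100"
  shows "2 * a * w\<^sup>2 / (1 - w)\<^sup>2 \<le> 3 * a * r\<^sup>2"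
proof -
  have "(49 / 50)\<^sup>2 \<le> (1 - w)\<^sup>2" using assms by (intro power_mono) auto
  moreover have "2 * a * w\<^sup>2 \<le> 2 * a * (51 / 50 * r)\<^sup>2"
    using assms by (intro mult_left_mono power_mono) auto
  ultimately have "2 * a * w\<^sup>2 / (1 - w)\<^sup>2 \<le> 2 * a * (51 / 50 * r)\<^sup>2 / (49 / 50)\<^sup>2"
    using assms by (intro frac_le) auto
  also have "\<dots> \<le> 3 * a * r\<^sup>2" using assms by (simp add: power2_eq_square field_simps)
  finally show ?thesis .
qed

section \<open>One refinement step: the computed correction against the exact one\<close>

theorem theorem3p6:
  fixes A :: "real^('k::finite + 'm::finite)^('k + 'm)"
    and lam :: "'k + 'm \<Rightarrow> real"
    and x :: "'k + 'm \<Rightarrow> real^('k + 'm)"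
    and p :: "'k + 'm \<Rightarrow> 'k + 'm"
    and X Xhat Xtilde :: "real^'k^('k + 'm)"
    and H Hhat E :: "real^('k + 'm)^('k + 'm)"
    and D2 :: "real^'m^'m"
    and Yhat :: "real^'k^('k + 'm)"
    and That :: "real^'k^'k"
    and eps :: real
  assumes A_symmetric: "transpose A = A"
    and eigenpairs: "\<And>i. A *v x i = lam i *\<^sub>R x i" "\<And>i. norm (x i) = 1"
    and simple: "inj lam"
    and p_permutation: "p permutes UNIV"
    and X_def: "X = (\<chi> i j. x (p (Inl j)) $ i)"
    and H_orthogonal: "orthogonal_matrix H"
    and H_X: "transpose H ** X = I_nk"
    and H_A: "transpose H ** A ** H = block_diag (diag_mat (\<lambda>j. lam (p (Inl j)))) D2"
    and D2_symmetric: "transpose D2 = D2"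
    and Xhat_rank: "rank Xhat = CARD('k)"
    and Xhat_neq: "Xhat \<noteq> X"
    and Hhat_WY: "Hhat = mat 1 - Yhat ** That ** transpose Yhat"
    and Hhat_first_columns: "Hhat ** I_nk = Xhat"
    and Hhat_nonsingular: "invertible Hhat"
    and Xtilde_def: "Xtilde = refine_step A Xhat Hhat"
    and E_correction: "H = Hhat ** (mat 1 + E)"
    and eps_def: "eps = spectral_norm E"
    and eps_small: "eps < 1 / 100"
    and eps_gap: "\<And>j. CARD('k) \<noteq> 1 \<Longrightarrow>
          eps \<le> sqrt (gap (\<lambda>i. lam (p (Inl i))) j
                      / (2 * eta_fn eps * real CARD('k) * spectral_norm A))"
    and eps_lam: "\<And>j. eps < sqrt (\<bar>lam (p (Inl j))\<bar> / (eta_fn eps * spectral_norm A))"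
  shows "\<forall>j. norm (x (p (Inl j)) - column j Xtilde) / spectral_norm (X - Xhat)
      \<le> 1 / (1 - 2 * eps) *
        ((if CARD('k) = 1 then 0
          else omega_fn eps * sqrt (real CARD('k)) * spectral_norm A * eps
               / (gap (\<lambda>i. lam (p (Inl i))) j - 2 * eta_fn eps * spectral_norm A * eps^2))
         + (Max (range (\<lambda>i. \<bar>lam (p (Inr i))\<bar>)) + omega_fn eps * spectral_norm A * eps)
           / (\<bar>lam (p (Inl j))\<bar> - eta_fn eps * spectral_norm A * eps^2))"
proof
  fix j
  let ?mu = "\<lambda>i. lam (p (Inl i))" and ?e = "\<lambda>j. axis (Inl j) 1 :: real^('k + 'm)"
  define a where "a = spectral_norm A"
  define F where "F = transpose H ** Hhat"
  define G where "G = E ** F"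
  define D where "D = transpose H ** A ** H"
  define c where "c = d_tilde A Xhat"
  have eps0: "0 \<le> eps" by (simp add: eps_def spectral_norm_nonneg)
  note eta = eta_fn_ge[OF eps0 eps_small] and omega = omega_fn_ge[OF eps0 eps_small]
  have a0: "0 \<le> a" by (simp add: a_def spectral_norm_nonneg)
  have lam_le: "\<bar>lam i\<bar> \<le> a" for i
    unfolding a_def by (rule eigenvalue_le_spectral_norm[OF eigenpairs])

  have HH: "H ** transpose H = mat 1" "transpose H ** H = mat 1"
    using H_orthogonal by (auto simp: orthogonal_matrix_def)
  have HF: "Hhat = H ** F"
    by (simp add: F_def HH matrix_mul_assoc)
  have "F ** (mat 1 + E) = mat 1"
    using E_correction HH by (metis F_def matrix_mul_assoc)
  \<comment> \<open>With \<open>E\<close> outermost, the remainder in \<open>EFv\<close> is at most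
    \<open>eps * norm (F *v v)\<close>, which can be absorbed to bound \<open>F\<close>.\<close>
  then have EF: "(mat 1 + E) ** F = mat 1"
    by (simp add: matrix_left_right_inverse)
  have EFv: "v = F *v v + E *v (F *v v)" for v
    using EF by (metis matrix_vector_mul_assoc matrix_vector_mul_lid matrix_vector_mult_add_rdistrib)
  have F: "F = mat 1 - G"
    unfolding matrix_eq G_def matrix_vector_mult_diff_rdistrib matrix_vector_mul_lid
      matrix_vector_mul_assoc[symmetric]
    by (metis EFv add_diff_cancel_right')
  have Ev: "norm (E *v v) \<le> eps * norm v" for v
    unfolding eps_def by (rule spectral_norm_bound)
  have Fv0: "(1 - eps) * norm (F *v v) \<le> norm v" for v
  proof -
    have "norm (F *v v) \<le> norm v + norm (E *v (F *v v))"
      by (metis EFv add_diff_cancel_right' norm_triangle_ineq4)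
    then show ?thesis using Ev[of "F *v v"] by (simp add: algebra_simps)
  qed
  \<comment> \<open>\<open>51 / 50\<close> is a round upper bound for \<open>1 / (1 - eps)\<close>,
    which is below \<open>100 / 99\<close>.\<close>
  have Fv: "norm (F *v v) \<le> 51 / 50 * norm v" for v
  proof -
    have "(99 / 100) * norm (F *v v) \<le> (1 - eps) * norm (F *v v)"
      using eps_small by (intro mult_right_mono) auto
    then show ?thesis using Fv0[of v] norm_ge_zero[of v] by linarith
  qed
  have Gv: "norm (G *v v) \<le> 51 / 50 * eps * norm v" for v
  proof -
    have "norm (G *v v) \<le> eps * norm (F *v v)"
      using Ev[of "F *v v"] by (simp add: G_def matrix_vector_mul_assoc)
    also have "\<dots> \<le> eps * (51 / 50 * norm v)" by (intro mult_left_mono Fv eps0)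
    finally show ?thesis by simp
  qed

  have X: "column j X = x (p (Inl j))" for j
    by (simp add: X_def column_def vec_eq_iff)
  have "X = H ** I_nk"
    by (simp flip: H_X add: matrix_mul_assoc HH)
  then have He: "H *v ?e j = x (p (Inl j))" for j
    by (metis X column_I_nk column_matrix_mult)
  have Xhat: "column j Xhat = Hhat *v ?e j" for j
    by (metis Hhat_first_columns column_I_nk column_matrix_mult)
  have xhat: "column j Xhat = H *v ?e j - H *v (F *v (E *v ?e j))" for j
  proof -
    have "H *v ?e j = Hhat *v ?e j + Hhat *v (E *v ?e j)"
      unfolding E_correction
      by (simp add: matrix_vector_mul_assoc[symmetric] matrix_vector_mult_add_rdistrib matrix_vector_right_distrib)
    then show ?thesis by (simp add: Xhat HF matrix_vector_mul_assoc matrix_mul_assoc)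
  qed
  have w: "norm (H *v (F *v (E *v ?e j))) \<le> 51 / 50 * norm (E *v ?e j)" for j
    unfolding norm_orthogonal_matrix_mult[OF H_orthogonal] by (rule Fv)
  have Ee: "norm (E *v ?e j) \<le> eps" for j
    using Ev[of "?e j"] by simp

  have rayleigh: "\<bar>c j - ?mu j\<bar> \<le> 3 * a * (norm (E *v ?e j))\<^sup>2" for j
  proof -
    let ?w = "H *v (F *v (E *v ?e j))"
    have "norm ?w < 1" using w[of j] Ee[of j] eps_small by linarith
    moreover have "A *v (H *v ?e j) = ?mu j *\<^sub>R (H *v ?e j)" "norm (H *v ?e j) = 1"
      by (simp_all add: He eigenpairs)
    ultimately have "\<bar>c j - ?mu j\<bar> \<le> 2 * a * (norm ?w)\<^sup>2 / (1 - norm ?w)\<^sup>2"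
      unfolding c_def d_tilde_def alpha_def a_def
      by (intro rayleigh_quotient_error[OF A_symmetric _ _ xhat])
    also have "\<dots> \<le> 3 * a * (norm (E *v ?e j))\<^sup>2"
      using Ee[of j] eps_small by (intro rayleigh_error_numeric a0 w) auto
    finally show ?thesis .
  qed
  have rayleigh_eps: "\<bar>c j - ?mu j\<bar> \<le> 3 * a * eps\<^sup>2" for j
  proof -
    have "3 * a * (norm (E *v ?e j))\<^sup>2 \<le> 3 * a * eps\<^sup>2"
      using a0 by (intro mult_left_mono power_mono Ee) auto
    then show ?thesis using rayleigh[of j] by linarith
  qed
  \<comment> \<open>This puts the Rayleigh error into the shape that the denominators of the theorem
    allow for.\<close>
  have eta_eps: "3 * a * eps\<^sup>2 \<le> eta_fn eps * a * eps\<^sup>2"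
    using eta a0 by (intro mult_right_mono) auto

  have lam_pos: "0 < \<bar>?mu j\<bar> - eta_fn eps * a * eps\<^sup>2" and a_pos: "0 < a"
  proof -
    let ?z = "\<bar>?mu j\<bar> / (eta_fn eps * a)"
    have lt: "eps < sqrt ?z" using eps_lam[of j] by (simp add: a_def)
    \<comment> \<open>For \<open>a = 0\<close> the quotient \<open>?z\<close> is \<open>0\<close> by
      the convention for division, against \<open>0 \<le> eps\<close>.\<close>
    then show "0 < a" using a0 eps0 by (cases "a = 0") auto
    have "0 \<le> ?z" using a0 eta by auto
    then have "eps\<^sup>2 < ?z"
      using power_strict_mono[OF lt eps0, of 2] by simp
    then show "0 < \<bar>?mu j\<bar> - eta_fn eps * a * eps\<^sup>2"
      using \<open>0 < a\<close> eta by (simp add: pos_less_divide_eq mult_ac)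
  qed
  have mu_inj: "inj ?mu"
    using simple permutes_inj[OF p_permutation] by (auto simp: inj_def)
  \<comment> \<open>The hypothesis on the gap is not strict; its factor \<open>CARD('k)\<close>,
    here at least 2, shows that the subtracted term is at most half of the positive gap.\<close>
  have gap_gt: "0 < gap ?mu j - 2 * eta_fn eps * a * eps\<^sup>2" if k: "CARD('k) \<noteq> 1"
  proof -
    let ?K = "2 * eta_fn eps * real CARD('k) * a"
    have "0 < CARD('k)" by simp
    with k have "2 \<le> real CARD('k)" by linarith
    have "0 < ?K" using a_pos eta by simp
    have le: "eps \<le> sqrt (gap ?mu j / ?K)" using eps_gap[OF k] by (simp add: a_def)
    have g: "0 < gap ?mu j" by (rule gap_pos[OF k mu_inj])
    have "eps\<^sup>2 \<le> gap ?mu j / ?K"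
      using power_mono[OF le eps0, of 2] g \<open>0 < ?K\<close> by simp
    then have "eps\<^sup>2 * ?K \<le> gap ?mu j"
      using \<open>0 < ?K\<close> by (simp add: pos_le_divide_eq)
    moreover have "2 * (2 * eta_fn eps * a * eps\<^sup>2) \<le> real CARD('k) * (2 * eta_fn eps * a * eps\<^sup>2)"
      using \<open>2 \<le> real CARD('k)\<close> eta a0 by (intro mult_right_mono) auto
    ultimately show ?thesis using g by (simp add: mult_ac)
  qed

  \<comment> \<open>\<open>u\<close> is the exact correction column, \<open>y\<close> the error of
    the computed one, and \<open>b\<close> the deviation of the column of \<open>V_mat\<close> from
    its first-order form.\<close>
  define u where "u = E *v ?e j"
  define r where "r = norm u"
  define y where "y = column j (E_tilde A Xhat Hhat) - u"
  define b where "b = column j (V_mat A Xhat Hhat) - ((?mu j - c j) *\<^sub>R ?e j - (D *v u - c j *\<^sub>R u))"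
  have r: "0 \<le> r" "r \<le> eps" using Ee by (auto simp: r_def u_def)
  have V: "column j (V_mat A Xhat Hhat)
      = transpose Hhat *v (A *v column j Xhat - c j *\<^sub>R column j Xhat)"
  proof -
    have "column j (Xhat ** diag_mat c) = c j *\<^sub>R column j Xhat"
      by (simp add: vec_eq_iff column_def matrix_matrix_mult_def diag_mat_def
          if_distrib[where f="\<lambda>x. _ * x"] mult.commute cong: if_cong)
    moreover have "column j (P - Q) = column j P - column j Q" for P Q :: "real^'k^('k + 'm)"
      by (simp add: vec_eq_iff column_def)
    ultimately show ?thesis
      by (simp add: V_mat_def column_matrix_mult c_def)
  qed
  have b: "norm b \<le> 17 / 4 * a * eps * r"
  proof -
    have "norm b \<le> 3 * a * r\<^sup>2 * (51 / 50 * eps)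
        + (2 * (51 / 50 * eps) + (51 / 50 * eps)\<^sup>2) * (2 * a + 3 * a * r\<^sup>2) * r"
      unfolding b_def V unfolding D_def HF a_def r_def
      using rayleigh[of j] eps0 lam_le
      by (intro residual_column_expansion[OF _ _ H_orthogonal F Gv])
         (auto simp: He eigenpairs xhat u_def a_def)
    also have "\<dots> \<le> 17 / 4 * a * eps * r"
      by (rule residual_error_numeric[OF a0 r eps_small])
    finally show ?thesis .
  qed
  have D: "D = block_diag (diag_mat ?mu) D2" by (simp add: D_def H_A)

  define m where "m = Max (range (\<lambda>i. \<bar>lam (p (Inr i))\<bar>))"
  have m_ge: "\<bar>lam (p (Inr i))\<bar> \<le> m" for i unfolding m_def by (rule Max_ge) auto
  then have m0: "0 \<le> m" by (meson abs_ge_zero order_trans)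
  \<comment> \<open>Since \<open>D\<close> is block diagonal, \<open>D *v u\<close> and
    \<open>D *v v\<close> agree in the last rows, while \<open>H *v v\<close> is orthogonal to every
    selected eigenvector.\<close>
  define v :: "real^('k + 'm)" where "v = (\<chi> i. case i of Inl _ \<Rightarrow> 0 | Inr l \<Rightarrow> u $ Inr l)"
  have v: "v $ Inl i = 0" "v $ Inr l = u $ Inr l" for i l by (simp_all add: v_def)
  have Dv: "norm (D *v v) \<le> m * r"
  proof -
    have "orthogonal_matrix (transpose H)" using H_orthogonal by simp
    then have "norm (D *v v) = norm (A *v (H *v v))"
      by (metis D_def matrix_vector_mul_assoc norm_orthogonal_matrix_mult)
    also have "\<dots> \<le> m * norm (H *v v)"
    proof (rule norm_mult_eigenspace_le[OF A_symmetric, of "\<lambda>i. x (p i)" "\<lambda>i. lam (p i)"])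
      show "inj (\<lambda>i. lam (p i))"
        using simple permutes_inj[OF p_permutation] by (auto simp: inj_def)
      show "x (p i) \<bullet> (H *v v) = 0 \<or> \<bar>lam (p i)\<bar> \<le> m" for i
      proof (cases i)
        case (Inl l)
        have "x (p (Inl l)) \<bullet> (H *v v) = ?e l \<bullet> v"
          using H_orthogonal He[of l] orthogonal_transformation_matrix[of "(*v) H"]
          by (metis matrix_of_matrix_vector_mul matrix_vector_mul_linear orthogonal_transformation_def)
        then show ?thesis by (simp add: Inl inner_axis' v)
      qed (simp add: m_ge)
    qed (use m0 eigenpairs in auto)
    also have "norm (H *v v) = norm v" by (rule norm_orthogonal_matrix_mult[OF H_orthogonal])
    also have "norm v \<le> r" unfolding r_def
    proof (rule norm_le_componentwise_cart)
      show "norm (v $ i) \<le> norm (u $ i)" for i by (cases i) (simp_all add: v)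
    qed
    finally show ?thesis using m0 by (simp add: mult_left_mono)
  qed

  define den1 where "den1 = gap ?mu j - 2 * eta_fn eps * a * eps\<^sup>2"
  define den2 where "den2 = \<bar>?mu j\<bar> - eta_fn eps * a * eps\<^sup>2"
  have den2: "0 < den2" "den2 \<le> \<bar>c j\<bar>" "den2 \<le> a"
  proof -
    have "0 \<le> eta_fn eps * a * eps\<^sup>2" using eta a0 by simp
    then show "0 < den2" "den2 \<le> \<bar>c j\<bar>" "den2 \<le> a"
      unfolding den2_def
      using lam_pos rayleigh_eps[of j] eta_eps lam_le[of "p (Inl j)"] by linarith+
  qed
  \<comment> \<open>Both quotients \<open>c j\<close> and \<open>c i\<close> are perturbed, hence
    the factor 2 in \<open>den1\<close>.\<close>
  have den1: "den1 \<le> \<bar>c j - c i\<bar>" if "i \<noteq> j" for i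
    using gap_le[OF that, of ?mu] rayleigh_eps[of j] rayleigh_eps[of i] eta_eps
    unfolding den1_def by linarith

  have Vb: "V_mat A Xhat Hhat $ i $ j
      = b $ i + (?mu j - c j) * (if i = Inl j then 1 else 0) - (D *v u) $ i + c j * u $ i" for i
  proof -
    have "V_mat A Xhat Hhat $ i $ j = column j (V_mat A Xhat Hhat) $ i"
      by (simp add: column_def)
    also have "column j (V_mat A Xhat Hhat)
        = b + (?mu j - c j) *\<^sub>R ?e j - (D *v u) + c j *\<^sub>R u"
      by (simp add: b_def)
    finally show ?thesis by (simp add: axis_def)
  qed

  \<comment> \<open>For \<open>k = 1\<close> there is no off-diagonal index, so \<open>0\<close> is
    the right default and matches the absent first term of the bound.\<close>
  define t where "t = (if CARD('k) = 1 then 0 else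
      (1 / den1) *\<^sub>R (\<chi> i. \<bar>b $ i\<bar> + 3 * a * eps\<^sup>2 * \<bar>u $ i\<bar>))"
  define s where "s = (1 / c j) *\<^sub>R (b - D *v v)"
  have y: "norm y \<le> 31 / 20 * eps * r + norm t + norm s"
  proof (rule norm_sum_type_le)
    \<comment> \<open>Halving \<open>1 - alpha Xhat j\<close> reproduces \<open>u $ Inl j\<close> to
      first order. The rest is the \<open>G\<close> term and half a square, with
      \<open>51 / 50 + 53 / 100 = 31 / 20\<close>.\<close>
    have "alpha Xhat j = 1 - 2 * (F *v u) $ Inl j + (norm (F *v u))\<^sup>2"
    proof -
      have "alpha Xhat j = (norm (H *v (?e j - F *v u)))\<^sup>2"
        by (simp add: alpha_def power2_norm_eq_inner xhat matrix_vector_mult_diff_distrib u_def)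
      also have "\<dots> = (?e j - F *v u) \<bullet> (?e j - F *v u)"
        by (simp add: norm_orthogonal_matrix_mult[OF H_orthogonal] power2_norm_eq_inner)
      also have "\<dots> = 1 - 2 * (F *v u) $ Inl j + (norm (F *v u))\<^sup>2"
        by (simp add: inner_diff_left inner_diff_right inner_axis inner_axis' power2_norm_eq_inner)
      finally show ?thesis .
    qed
    moreover have "(F *v u) $ Inl j = u $ Inl j - (G *v u) $ Inl j"
      by (simp add: F matrix_vector_mult_diff_rdistrib)
    ultimately have "y $ Inl j = - (G *v u) $ Inl j - (norm (F *v u))\<^sup>2 / 2"
      by (simp add: y_def column_def E_tilde_def field_simps)
    moreover have "\<bar>(G *v u) $ Inl j\<bar> \<le> 51 / 50 * eps * r"
      unfolding r_def by (rule order_trans[OF component_le_norm_cart Gv])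
    moreover have "(norm (F *v u))\<^sup>2 / 2 \<le> 53 / 100 * eps * r"
    proof -
      have "(norm (F *v u))\<^sup>2 \<le> (51 / 50 * r)\<^sup>2"
        unfolding r_def by (intro power_mono Fv) auto
      moreover have "r * r \<le> eps * r" using r by (intro mult_right_mono) auto
      moreover have "0 \<le> eps * r" using r eps0 by simp
      ultimately show ?thesis by (simp add: power2_eq_square)
    qed
    ultimately show "\<bar>y $ Inl j\<bar> \<le> 31 / 20 * eps * r"
      using zero_le_power2[of "norm (F *v u)"] by linarith
  next
    fix i assume "i \<noteq> j"
    then have k: "CARD('k) \<noteq> 1" by (metis (full_types) UNIV_I card_1_singletonE singletonD)
    then have d1: "0 < den1" using gap_gt by (simp add: den1_def)
    have cc: "0 < \<bar>c j - c i\<bar>" using d1 den1[OF \<open>i \<noteq> j\<close>] by linarith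
    have "y $ Inl i = V_mat A Xhat Hhat $ Inl i $ j / (c j - c i) - u $ Inl i"
      using \<open>i \<noteq> j\<close> by (simp add: y_def column_def E_tilde_def c_def)
    \<comment> \<open>The terms with \<open>c j\<close> cancel; what remains beside \<open>b\<close>
      is the small Rayleigh error at \<open>i\<close> times \<open>u $ Inl i\<close>.\<close>
    also have "\<dots> = (b $ Inl i + (c i - ?mu i) * u $ Inl i) / (c j - c i)"
      using cc \<open>i \<noteq> j\<close> by (simp add: Vb D block_diag_mult_Inl field_simps)
    finally have "\<bar>y $ Inl i\<bar> = \<bar>b $ Inl i + (c i - ?mu i) * u $ Inl i\<bar> / \<bar>c j - c i\<bar>"
      by (simp add: abs_divide)
    also have "\<dots> \<le> (\<bar>b $ Inl i\<bar> + 3 * a * eps\<^sup>2 * \<bar>u $ Inl i\<bar>) / den1"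
    proof (rule frac_le[OF _ _ d1 den1[OF \<open>i \<noteq> j\<close>]])
      show "\<bar>b $ Inl i + (c i - ?mu i) * u $ Inl i\<bar> \<le> \<bar>b $ Inl i\<bar> + 3 * a * eps\<^sup>2 * \<bar>u $ Inl i\<bar>"
        by (rule order_trans[OF abs_triangle_ineq])
           (auto simp: abs_mult intro!: mult_right_mono rayleigh_eps)
    qed (use a0 in auto)
    also have "\<dots> = t $ Inl i" using k by (simp add: t_def)
    finally show "\<bar>y $ Inl i\<bar> \<le> \<bar>t $ Inl i\<bar>" by linarith
  next
    fix i
    have "c j \<noteq> 0" using den2 by auto
    have "(D *v u) $ Inr i = (D *v v) $ Inr i"
      unfolding D by (rule block_diag_mult_Inr) (simp add: v)
    \<comment> \<open>Division by \<open>c j\<close> recovers \<open>u\<close> exactly and leaves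
      \<open>b\<close> and the term with \<open>D\<close>, since no approximation of the lower block
      is subtracted.\<close>
    then have "y $ Inr i = s $ Inr i"
      using \<open>c j \<noteq> 0\<close> by (simp add: y_def column_def E_tilde_def flip: c_def)
        (simp add: Vb s_def field_simps)
    then show "\<bar>y $ Inr i\<bar> \<le> \<bar>s $ Inr i\<bar>" by simp
  qed

  define R1 where "R1 = (if CARD('k) = 1 then 0
      else omega_fn eps * sqrt (real CARD('k)) * a * eps / den1)"
  define R2 where "R2 = (m + omega_fn eps * a * eps) / den2"
  have aer: "0 \<le> a * eps * r" using a0 eps0 r by simp
  have t: "norm t \<le> R1 * r"
  proof (cases "CARD('k) = 1")
    case False
    then have d1: "0 < den1" using gap_gt by (simp add: den1_def)
    let ?b = "(\<chi> i. \<bar>b $ i\<bar>) :: real^('k + 'm)" and ?u = "(\<chi> i. \<bar>u $ i\<bar>) :: real^('k + 'm)"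
    have "(\<chi> i. \<bar>b $ i\<bar> + 3 * a * eps\<^sup>2 * \<bar>u $ i\<bar>) = ?b + (3 * a * eps\<^sup>2) *\<^sub>R ?u"
      by (simp add: vec_eq_iff)
    then have "norm t = norm (?b + (3 * a * eps\<^sup>2) *\<^sub>R ?u) / den1"
      using False d1 by (simp add: t_def)
    \<comment> \<open>The factors 6 and 1 are to be matched with \<open>omega_fn eps\<close> and
      \<open>sqrt (real CARD('k))\<close>; the sum needed is only
      \<open>17 / 4 + 3 / 100\<close>.\<close>
    also have "\<dots> \<le> (6 * 1 * a * eps * r) / den1"
    proof (rule divide_right_mono)
      have "norm ?b \<le> norm b" "norm ?u \<le> norm u"
        by (rule norm_le_componentwise_cart, simp)+
      then have "norm ((3 * a * eps\<^sup>2) *\<^sub>R ?u) \<le> 3 * a * eps\<^sup>2 * r"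
        using a0 by (simp add: r_def mult_left_mono)
      also have "\<dots> = 3 * (a * eps * r) * eps" by (simp add: power2_eq_square)
      also have "\<dots> \<le> 3 * (a * eps * r) * (1 / 100)"
        using eps_small aer by (intro mult_left_mono) auto
      finally show "norm (?b + (3 * a * eps\<^sup>2) *\<^sub>R ?u) \<le> 6 * 1 * a * eps * r"
        using norm_triangle_ineq[of ?b "(3 * a * eps\<^sup>2) *\<^sub>R ?u"] \<open>norm ?b \<le> norm b\<close> b aer
        by (simp add: mult.assoc)
    qed (use d1 in simp)
    also have "\<dots> \<le> (omega_fn eps * sqrt (real CARD('k)) * a * eps * r) / den1"
      using d1 omega a0 eps0 r by (intro divide_right_mono mult_right_mono mult_mono) auto
    finally show ?thesis using False by (simp add: R1_def)
  qed (simp add: t_def R1_def)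
  \<comment> \<open>The diagonal entry is charged to the second term: for \<open>k = 1\<close> the first one is absent.\<close>
  have s: "31 / 20 * eps * r + norm s \<le> R2 * r"
  proof -
    have "norm s = norm (b - D *v v) / \<bar>c j\<bar>" by (simp add: s_def)
    also have "\<dots> \<le> (17 / 4 * a * eps * r + m * r) / den2"
      using den2 aer m0 r b Dv norm_triangle_ineq4[of b "D *v v"] by (intro frac_le) auto
    finally have 1: "norm s \<le> (17 / 4 * a * eps * r + m * r) / den2" .
    \<comment> \<open>The diagonal error carries no denominator; \<open>den2 \<le> a\<close> allows
      it to be written over \<open>den2\<close>.\<close>
    have "den2 * (31 / 20 * eps * r) \<le> a * (31 / 20 * eps * r)"
      using den2 eps0 r by (intro mult_right_mono) auto
    then have "31 / 20 * eps * r \<le> (31 / 20 * a * eps * r) / den2"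
      using den2 by (simp add: pos_le_divide_eq mult_ac)
    with 1 have "31 / 20 * eps * r + norm s
        \<le> (31 / 20 * a * eps * r + (17 / 4 * a * eps * r + m * r)) / den2"
      unfolding add_divide_distrib by linarith
    also have "\<dots> \<le> (m * r + omega_fn eps * (a * eps * r)) / den2"
    proof (rule divide_right_mono)
      \<comment> \<open>The coefficients add up to \<open>31 / 20 + 17 / 4 = 29 / 5\<close>, just
        below 6.\<close>
      have "6 * (a * eps * r) \<le> omega_fn eps * (a * eps * r)"
        using omega aer by (rule mult_right_mono)
      then show "31 / 20 * a * eps * r + (17 / 4 * a * eps * r + m * r)
          \<le> m * r + omega_fn eps * (a * eps * r)"
        using aer by (simp add: mult.assoc)
    qed (use den2 in simp)
    finally show ?thesis by (simp add: R2_def algebra_simps)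
  qed
  have yr: "norm y \<le> (R1 + R2) * r" using y t s by (simp add: algebra_simps)
  have R: "0 \<le> R1 + R2"
  proof -
    have "0 \<le> R1"
      using omega a0 eps0 gap_gt by (auto simp: R1_def less_imp_le simp flip: den1_def)
    moreover have "0 \<le> R2" using omega a0 eps0 m0 den2 by (simp add: R2_def)
    ultimately show ?thesis by simp
  qed

  let ?N = "spectral_norm (X - Xhat)"
  have N: "0 < ?N" using Xhat_neq by (intro spectral_norm_pos) simp
  \<comment> \<open>The chain uses \<open>u = F *v u + E *v (F *v u)\<close>, where
    \<open>H *v (F *v u)\<close> is the column of \<open>X - Xhat\<close>. This converts the factor
    \<open>r\<close> into the denominator of the theorem.\<close>
  have rN: "r \<le> (1 + eps) * ?N"
  proof -
    have "r \<le> norm (F *v u) + norm (E *v (F *v u))"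
      unfolding r_def by (metis EFv norm_triangle_ineq)
    also have "\<dots> \<le> (1 + eps) * norm (F *v u)"
      using Ev[of "F *v u"] by (simp add: algebra_simps)
    also have "norm (F *v u) = norm (column j (X - Xhat))"
    proof -
      have "column j (X - Xhat) = H *v (F *v u)"
        using xhat[of j] by (simp add: He u_def flip: X) (simp add: vec_eq_iff column_def)
      then show ?thesis by (simp add: norm_orthogonal_matrix_mult[OF H_orthogonal])
    qed
    also have "column j (X - Xhat) = (X - Xhat) *v axis j 1"
      by (simp add: matrix_vector_mult_basis)
    also have "norm \<dots> \<le> ?N" using spectral_norm_bound[of "X - Xhat" "axis j 1"] by simp
    finally show ?thesis using eps0 by (simp add: mult_left_mono)
  qed

  have "x (p (Inl j)) - column j Xtilde = - (Hhat *v y)"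
  proof -
    have "column j Xtilde = column j Xhat + Hhat *v column j (E_tilde A Xhat Hhat)"
      unfolding Xtilde_def refine_step_def column_matrix_mult[symmetric]
      by (simp add: column_def vec_eq_iff)
    moreover have "x (p (Inl j)) = column j Xhat + Hhat *v u"
      using xhat[of j] by (simp add: He HF u_def matrix_vector_mul_assoc matrix_mul_assoc)
    ultimately show ?thesis by (simp add: y_def matrix_vector_mult_diff_distrib)
  qed
  then have eq: "norm (x (p (Inl j)) - column j Xtilde) = norm (F *v y)"
    by (simp add: HF norm_orthogonal_matrix_mult[OF H_orthogonal] flip: matrix_vector_mul_assoc)
  have "(1 - eps) * norm (F *v y) \<le> (R1 + R2) * ((1 + eps) * ?N)"
    using Fv0[of y] yr mult_left_mono[OF rN R] by linarith
  then have "(1 - 2 * eps) * ((1 - eps) * norm (F *v y))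
      \<le> (1 - 2 * eps) * ((R1 + R2) * ((1 + eps) * ?N))"
    using eps_small by (intro mult_left_mono) auto
  also have "\<dots> = ((1 - 2 * eps) * (1 + eps)) * ((R1 + R2) * ?N)" by (simp add: algebra_simps)
  also have "\<dots> \<le> (1 - eps) * ((R1 + R2) * ?N)"
  proof (rule mult_right_mono)
    \<comment> \<open>The two sides differ by \<open>2 * eps\<^sup>2\<close>.\<close>
    show "(1 - 2 * eps) * (1 + eps) \<le> 1 - eps" by (simp add: algebra_simps)
    show "0 \<le> (R1 + R2) * ?N" using R N by simp
  qed
  finally have "(1 - eps) * ((1 - 2 * eps) * norm (F *v y)) \<le> (1 - eps) * ((R1 + R2) * ?N)"
    by (simp add: mult_ac)
  then have "(1 - 2 * eps) * norm (F *v y) \<le> (R1 + R2) * ?N"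
    using eps_small by simp
  then have "norm (F *v y) / ?N \<le> 1 / (1 - 2 * eps) * (R1 + R2)"
    using N eps_small by (simp add: field_simps)
  then show "norm (x (p (Inl j)) - column j Xtilde) / ?N
      \<le> 1 / (1 - 2 * eps) *
        ((if CARD('k) = 1 then 0
          else omega_fn eps * sqrt (real CARD('k)) * spectral_norm A * eps
               / (gap (\<lambda>i. lam (p (Inl i))) j - 2 * eta_fn eps * spectral_norm A * eps^2))
         + (Max (range (\<lambda>i. \<bar>lam (p (Inr i))\<bar>)) + omega_fn eps * spectral_norm A * eps)
           / (\<bar>lam (p (Inl j))\<bar> - eta_fn eps * spectral_norm A * eps^2))"
    unfolding eq R1_def R2_def den1_def den2_def m_def a_def .
qed

end
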